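(* There is a randomized algorithm which, given the vertex set $V(G)$ of a graph $G$ (whose edges are unknown), a positive integer $k$, and access to a BIS oracle for $G$, makes $\mathcal{O}(k^8\log k)$ BIS queries and, with probability at least $1-1/k^{c}$ for some constant $c>0$, correctly decides whether $G$ has a vertex cover of size at most $k$.
   Context: The BIS (bipartite independent set) oracle takes as input two disjoint non-empty subsets $A,B\subseteq V(G)$ and answers whether there exists an edge $(u,v)\in E(G)$ with $u\in A$ and $v\in B$ (yes/no only). A vertex cover is a set of vertices containing at least one endpoint of every edge. Only oracle queries are counted. *)

theory Defs
  imports "HOL-Probability.Probability" "Graph_Theory.Graph_Theory"
begin

text \<open>
  Finite simple graphs are the library's \<open>pair_graph\<close>s: finite, symmetric, loop-free
  digraphs without parallel arcs, an edge being a pair of opposite arcs.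
\<close>

definition vertex_cover :: "'a pair_pre_digraph \<Rightarrow> 'a set \<Rightarrow> bool" where
  "vertex_cover G S \<longleftrightarrow> S \<subseteq> pverts G \<and> (\<forall>(u, v) \<in> parcs G. u \<in> S \<or> v \<in> S)"

definition has_vertex_cover_of_size_at_most :: "'a pair_pre_digraph \<Rightarrow> nat \<Rightarrow> bool" where
  "has_vertex_cover_of_size_at_most G k \<longleftrightarrow> (\<exists>S. vertex_cover G S \<and> card S \<le> k)"

definition bis :: "'a pair_pre_digraph \<Rightarrow> 'a set \<Rightarrow> 'a set \<Rightarrow> bool" where
  "bis G A B \<longleftrightarrow> (\<exists>u \<in> A. \<exists>v \<in> B. (u, v) \<in> parcs G)"

text \<open>
  A randomized adaptive query algorithm on a fixed vertex set is a finite tree: \<open>Coin\<close> tosses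
  a fair coin, and \<open>Query A B t u\<close> asks the oracle about \<open>(A, B)\<close> and continues with \<open>t\<close> on
  the answer yes and with \<open>u\<close> on the answer no. Computation between queries is free, so it is
  not represented. The tree depends on the graph only through the oracle passed to \<open>run\<close>.
\<close>

datatype 'a query_alg =
    Answer bool
  | Coin "'a query_alg" "'a query_alg"
  | Query "'a set" "'a set" "'a query_alg" "'a query_alg"

fun legal_bis_queries :: "'a set \<Rightarrow> 'a query_alg \<Rightarrow> bool" where
  "legal_bis_queries V (Answer b) \<longleftrightarrow> True"
| "legal_bis_queries V (Coin t u) \<longleftrightarrow> legal_bis_queries V t \<and> legal_bis_queries V u"
| "legal_bis_queries V (Query A B t u) \<longleftrightarrow>
     A \<subseteq> V \<and> B \<subseteq> V \<and> A \<noteq> {} \<and> B \<noteq> {} \<and> A \<inter> B = {} \<and>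
     legal_bis_queries V t \<and> legal_bis_queries V u"

text \<open>Joint distribution of the answer and the number of oracle queries made.\<close>

fun run :: "('a set \<Rightarrow> 'a set \<Rightarrow> bool) \<Rightarrow> 'a query_alg \<Rightarrow> (bool \<times> nat) pmf" where
  "run oracle_ans (Answer b) = return_pmf (b, 0)"
| "run oracle_ans (Coin t u) =
     bind_pmf (bernoulli_pmf (1 / 2)) (\<lambda>h. if h then run oracle_ans t else run oracle_ans u)"
| "run oracle_ans (Query A B t u) =
     map_pmf (\<lambda>(b, m). (b, Suc m))
       (if oracle_ans A B then run oracle_ans t else run oracle_ans u)"

end

theory Submission
  imports Defs "HOL-Real_Asymp.Real_Asymp"
begin

text \<open>
  Colour the vertices uniformly at random with \<open>\<Theta>(k\<^sup>3)\<close> colours, query every pair of nonempty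
  colour classes, and decide whether the quotient graph has a cover of size at most \<open>k\<close>.
  A cover of \<open>G\<close> projects to the quotient, so an error can only occur if \<open>G\<close> has no such cover.
  In that case, a minimal edge set without such a cover spans at most \<open>2 (k + 1)\<close> vertices
  (Erdos--Gallai), and the answer is correct as soon as the colouring is injective on these, which
  fails with probability at most \<open>1 / k\<close> by a union bound. So \<open>O(k\<^sup>6)\<close> queries suffice.
\<close>

section \<open>Critical edge sets\<close>

definition covers :: "'a set \<Rightarrow> 'a rel \<Rightarrow> bool" where
  "covers S E \<longleftrightarrow> (\<forall>(u, v) \<in> E. u \<in> S \<or> v \<in> S)"

text \<open>Stated for arbitrary relations, so that it applies to the arcs of a graph, to subsets of
  them, and to a quotient whose vertices are themselves sets.\<close>

definition coverable :: "nat \<Rightarrow> 'a rel \<Rightarrow> bool" where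
  "coverable k E \<longleftrightarrow> (\<exists>S. finite S \<and> card S \<le> k \<and> covers S E)"

text \<open>Both directions count, because deleting arcs one at a time may leave a relation that is
  not symmetric.\<close>

definition nbrs :: "'a rel \<Rightarrow> 'a set \<Rightarrow> 'a set" where
  "nbrs E A = E `` A \<union> E\<inverse> `` A"

lemma nbrs_mono: "A \<subseteq> B \<Longrightarrow> nbrs E A \<subseteq> nbrs E B"
  unfolding nbrs_def by blast

lemma finite_nbrs: "finite E \<Longrightarrow> finite (nbrs E A)"
  unfolding nbrs_def by (simp add: finite_Image)

text \<open>An exchange argument. If an independent \<open>A\<close> outnumbered its neighbours, a
  cover of \<open>E\<close> minus one edge at \<open>A\<close> could trade its part inside
  \<open>A\<close> for the neighbours it misses. The result would be no larger and would cover all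
  of \<open>E\<close>.\<close>

lemma card_le_nbrs_if_critical:
  assumes fin: "finite E" and uncov: "\<not> coverable k E"
    and crit: "\<And>e. e \<in> E \<Longrightarrow> coverable k (E - {e})"
    and "finite A" "A \<subseteq> Field E" "A \<inter> nbrs E A = {}"
  shows "card A \<le> card (nbrs E A)"
  using assms(4-6)
proof (induction A rule: finite_psubset_induct)
  case (psubset A)
  show ?case
  proof (rule ccontr)
    assume contr: "\<not> card A \<le> card (nbrs E A)"
    then have "A \<noteq> {}" by auto
    then obtain a where a: "a \<in> A" by blast
    with psubset.prems obtain e b where e: "e \<in> E" "e = (a, b) \<or> e = (b, a)"
      unfolding Field_def by blast
    then have b: "b \<in> nbrs E A" using a unfolding nbrs_def by blast
    obtain T where T: "finite T" "card T \<le> k" "covers T (E - {e})"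
      using crit[OF e(1)] unfolding coverable_def by blast
    \<comment> \<open>Otherwise \<open>T\<close> would cover \<open>e\<close> too, hence all of
      \<open>E\<close>.\<close>
    have "a \<notin> T" "b \<notin> T"
      using uncov T e(2) unfolding coverable_def covers_def by blast+
    let ?N = "nbrs E A" and ?B = "A - T - {a}"
    have finN: "finite ?N" using fin by (rule finite_nbrs)
    have "b \<notin> A" using b psubset.prems(2) by blast
    \<comment> \<open>An edge at \<open>x\<close> in \<open>?B\<close> is not \<open>e\<close>, so
      \<open>T\<close> covers it; as \<open>x\<close> is outside \<open>T\<close>, the other end
      must lie in \<open>T\<close>.\<close>
    have NB: "nbrs E ?B \<subseteq> ?N \<inter> T"
    proof
      fix y assume "y \<in> nbrs E ?B"
      then obtain x where x: "x \<in> ?B" and xy: "(x, y) \<in> E \<or> (y, x) \<in> E"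
        unfolding nbrs_def by blast
      have "x \<noteq> a" "x \<noteq> b" using x \<open>b \<notin> A\<close> by auto
      then have "(x, y) \<noteq> e" "(y, x) \<noteq> e" using e(2) by auto
      then have "y \<in> T" using T(3) x xy unfolding covers_def by blast
      moreover have "y \<in> ?N" using x xy unfolding nbrs_def by blast
      ultimately show "y \<in> ?N \<inter> T" by blast
    qed
    have "?B \<subset> A" using a by blast
    then have "card ?B \<le> card (nbrs E ?B)"
      using psubset.IH[of ?B] psubset.prems nbrs_mono[of ?B A E] by blast
    also have "\<dots> \<le> card (?N \<inter> T)"
      by (intro card_mono NB) (use finN in auto)
    finally have "card ?B \<le> card (?N \<inter> T)" .
    moreover have "card (A - T) = Suc (card ?B)"
      using a \<open>a \<notin> T\<close> psubset.hyps by (intro card.remove) auto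
    moreover have "card A = card (A \<inter> T) + card (A - T)"
      using psubset.hyps card_Int_Diff by blast
    moreover have "card ?N = card (?N \<inter> T) + card (?N - T)"
      using finN card_Int_Diff by blast
    \<comment> \<open>The loss of one from leaving \<open>a\<close> out of \<open>?B\<close> is made
      up by the strict inequality \<open>card ?N < card A\<close>.\<close>
    ultimately have le: "card (?N - T) \<le> card (A \<inter> T)" using contr by linarith
    \<comment> \<open>This set contains all of \<open>?N\<close>, because
      \<open>?N \<inter> T\<close> is disjoint from \<open>A\<close> and survives in
      \<open>T - A\<close>. Hence it covers every edge meeting \<open>A\<close>, including
      \<open>e\<close>; the other edges are covered by \<open>T\<close> outside
      \<open>A\<close>.\<close>
    let ?T' = "(T - A) \<union> (?N - T)"
    have "card ?T' \<le> card (T - A) + card (?N - T)" by (rule card_Un_le)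
    also have "\<dots> \<le> card (T - A) + card (T \<inter> A)" using le by (simp add: Int_commute)
    also have "\<dots> = card T" using card_Int_Diff[OF T(1), of A] by simp
    finally have "card ?T' \<le> k" using T(2) by simp
    moreover have "covers ?T' E"
    proof -
      have "u \<in> ?T' \<or> v \<in> ?T'" if uv: "(u, v) \<in> E" for u v
      proof (cases "u \<in> A \<or> v \<in> A")
        case True
        then have "u \<in> ?N \<or> v \<in> ?N" using uv unfolding nbrs_def by blast
        then show ?thesis using psubset.prems by blast
      next
        case False
        then have "(u, v) \<noteq> e" using e a by auto
        then show ?thesis using False T(3) uv unfolding covers_def by blast
      qed
      then show ?thesis unfolding covers_def by blast
    qed
    moreover have "finite ?T'" using T(1) finN by simp
    ultimately have "coverable k E" unfolding coverable_def by (intro exI[of _ ?T'] conjI)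
    with uncov show False by contradiction
  qed
qed

lemma finite_minimal_not_coverable:
  assumes "finite E" "\<not> coverable k E"
  obtains F where "F \<subseteq> E" "\<not> coverable k F" "\<And>e. e \<in> F \<Longrightarrow> coverable k (F - {e})"
proof -
  have "\<exists>F \<subseteq> E. \<not> coverable k F \<and> (\<forall>e \<in> F. coverable k (F - {e}))"
    using assms
  proof (induction E rule: finite_psubset_induct)
    case (psubset E)
    show ?case
    proof (cases "\<forall>e \<in> E. coverable k (E - {e})")
      case False
      then obtain e where "e \<in> E" "\<not> coverable k (E - {e})" by blast
      then show ?thesis using psubset.IH[of "E - {e}"] by blast
    qed (use psubset.prems in blast)
  qed
  then show ?thesis using that by blast
qed

text \<open>In a minimal \<open>F\<close>, a cover of all arcs but one, together with an end of that
  arc, is a cover of size at most \<open>k + 1\<close>. The remaining vertices are independent and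
  have all their neighbours in this cover, so by criticality they number at most
  \<open>k + 1\<close> as well.\<close>

lemma small_not_coverable_subset:
  assumes "finite E" "\<not> coverable k E"
  obtains F where "F \<subseteq> E" "\<not> coverable k F" "card (Field F) \<le> 2 * (k + 1)"
proof -
  obtain F where F: "F \<subseteq> E" "\<not> coverable k F" "\<And>e. e \<in> F \<Longrightarrow> coverable k (F - {e})"
    using finite_minimal_not_coverable[OF assms] by blast
  have fin: "finite F" using F(1) assms(1) by (rule finite_subset)
  have "F \<noteq> {}" using F(2) unfolding coverable_def covers_def by fastforce
  then obtain x y where xy: "(x, y) \<in> F" by auto
  then obtain T where T: "finite T" "card T \<le> k" "covers T (F - {(x, y)})"
    using F(3) unfolding coverable_def by blast
  let ?C = "insert x T" and ?I = "Field F - insert x T"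
  have cov: "covers ?C F" using T(3) unfolding covers_def by blast
  have "nbrs F ?I \<subseteq> ?C" using cov unfolding nbrs_def covers_def by blast
  moreover have "card ?I \<le> card (nbrs F ?I)"
    by (rule card_le_nbrs_if_critical[OF fin F(2,3)])
      (use fin calculation in \<open>auto simp: finite_Field\<close>)
  ultimately have "card ?I \<le> card ?C"
    using T(1) by (meson card_mono finite_insert order_trans)
  moreover have "card ?C \<le> k + 1" using T(1,2) by (simp add: card_insert_if)
  moreover have "card (Field F) \<le> card ?I + card ?C"
    using card_mono[of "?I \<union> ?C" "Field F"] card_Un_le[of ?I ?C] fin T(1)
    by (fastforce simp: finite_Field)
  ultimately have "card (Field F) \<le> 2 * (k + 1)" by simp
  with F(1,2) show ?thesis by (rule that)
qed

text \<open>Points outside the graph meet no arc, so a cover may be cut down to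
  \<open>pverts G\<close>.\<close>

lemma has_vertex_cover_iff_coverable:
  assumes "pair_graph G"
  shows "has_vertex_cover_of_size_at_most G k \<longleftrightarrow> coverable k (parcs G)"
proof
  interpret pair_graph G by fact
  show "has_vertex_cover_of_size_at_most G k \<Longrightarrow> coverable k (parcs G)"
    unfolding has_vertex_cover_of_size_at_most_def vertex_cover_def coverable_def covers_def
    using finite_subset[OF _ pair_finite_verts] by blast
  assume "coverable k (parcs G)"
  then obtain S where S: "finite S" "card S \<le> k" "covers S (parcs G)"
    unfolding coverable_def by blast
  have "card (S \<inter> pverts G) \<le> k"
    using S(1,2) card_mono[of S "S \<inter> pverts G"] by simp
  moreover have "vertex_cover G (S \<inter> pverts G)"
    using S(3) in_arcsD1 in_arcsD2 unfolding vertex_cover_def covers_def by blast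
  ultimately show "has_vertex_cover_of_size_at_most G k"
    unfolding has_vertex_cover_of_size_at_most_def by blast
qed

section \<open>Quotients by colourings\<close>

text \<open>Indexed by a vertex rather than by a colour: the classes of vertices in \<open>V\<close>
  are then nonempty, as a legal query demands.\<close>

definition colour_class :: "'a set \<Rightarrow> ('a \<Rightarrow> 'c) \<Rightarrow> 'a \<Rightarrow> 'a set" where
  "colour_class V g x = {y \<in> V. g y = g x}"

definition class_pairs :: "'a set \<Rightarrow> ('a \<Rightarrow> 'c) \<Rightarrow> ('a set \<times> 'a set) set" where
  "class_pairs V g =
    {(A, B). A \<in> colour_class V g ` V \<and> B \<in> colour_class V g ` V \<and> A \<noteq> B}"

definition quotient_arcs :: "'a pair_pre_digraph \<Rightarrow> ('a \<Rightarrow> 'c) \<Rightarrow> 'a set rel" where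
  "quotient_arcs G g = {(A, B) \<in> class_pairs (pverts G) g. bis G A B}"

lemma class_pairs_legal:
  assumes "(A, B) \<in> class_pairs V g"
  shows "A \<subseteq> V" "B \<subseteq> V" "A \<noteq> {}" "B \<noteq> {}" "A \<inter> B = {}"
  using assms unfolding class_pairs_def colour_class_def by auto

lemma finite_class_pairs: "finite V \<Longrightarrow> finite (class_pairs V g)"
  unfolding class_pairs_def
  by (rule finite_subset[of _ "colour_class V g ` V \<times> colour_class V g ` V"]) auto

lemma card_class_pairs_le:
  assumes "finite V" "g ` V \<subseteq> {..<m :: nat}"
  shows "card (class_pairs V g) \<le> m ^ 2"
proof -
  let ?P = "colour_class V g ` V"
  have "?P = (\<lambda>c. {y \<in> V. g y = c}) ` g ` V"
    unfolding colour_class_def by auto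
  then have "card ?P \<le> card (g ` V)"
    using assms(1) by (simp add: card_image_le)
  also have "\<dots> \<le> m"
    using card_mono[OF _ assms(2)] by simp
  finally have "card ?P \<le> m" .
  moreover have "card (class_pairs V g) \<le> card (?P \<times> ?P)"
    using assms(1) by (intro card_mono) (auto simp: class_pairs_def)
  ultimately show ?thesis
    by (simp add: card_cartesian_product power2_eq_square)
      (meson le_trans mult_le_mono)
qed

text \<open>Each arc of the quotient comes from an arc of \<open>G\<close>, so the classes of the
  vertices in a cover form a cover. This holds for every colouring, which makes the error
  one-sided.\<close>

lemma coverable_quotient_arcs:
  assumes "coverable k (parcs G)"
  shows "coverable k (quotient_arcs G g)"
proof -
  obtain S where S: "finite S" "card S \<le> k" "covers S (parcs G)"
    using assms unfolding coverable_def by blast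
  let ?c = "colour_class (pverts G) g"
  have "covers (?c ` S) (quotient_arcs G g)"
    unfolding covers_def
  proof (safe, goal_cases)
    case (1 A B)
    then obtain u v where "(u, v) \<in> parcs G" "u \<in> A" "v \<in> B"
      unfolding quotient_arcs_def bis_def by blast
    moreover from this 1 have "A = ?c u" "B = ?c v"
      unfolding quotient_arcs_def class_pairs_def colour_class_def by auto
    ultimately show ?case using S(3) 1(2) unfolding covers_def by blast
  qed
  moreover have "card (?c ` S) \<le> k"
    using card_image_le[OF S(1), of ?c] S(2) by simp
  ultimately show ?thesis using S(1) unfolding coverable_def by blast
qed

text \<open>Where the colouring is injective, \<open>F\<close> embeds into the quotient, and covers
  of the quotient pull back to covers of \<open>F\<close>.\<close>

lemma coverable_if_coverable_quotient_arcs: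
  assumes G: "pair_graph G" and F: "F \<subseteq> parcs G" and inj: "inj_on g (Field F)"
    and cov: "coverable k (quotient_arcs G g)"
  shows "coverable k F"
proof -
  interpret pair_graph G by fact
  let ?c = "colour_class (pverts G) g"
  obtain C where C: "finite C" "card C \<le> k" "covers C (quotient_arcs G g)"
    using cov unfolding coverable_def by blast
  have FV: "Field F \<subseteq> pverts G"
    using F in_arcsD1 in_arcsD2 unfolding Field_def by blast
  have inj': "inj_on ?c (Field F)"
  proof (rule inj_onI)
    fix x y assume *: "x \<in> Field F" "y \<in> Field F" "?c x = ?c y"
    then have "x \<in> ?c y" using FV unfolding colour_class_def by blast
    then show "x = y" using * inj unfolding colour_class_def inj_on_def by blast
  qed
  \<comment> \<open>The preimage of \<open>C\<close> under the class map; injectivity keeps it no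
    larger than \<open>C\<close>.\<close>
  let ?S = "{x \<in> Field F. ?c x \<in> C}"
  have inj_S: "inj_on ?c ?S" using inj' by (rule inj_on_subset) blast
  have finS: "finite ?S"
    using FV pair_finite_verts by (metis (no_types, lifting) finite_subset mem_Collect_eq subsetI)
  have "card ?S \<le> card C"
    using inj_S C(1) by (intro card_inj_on_le[of ?c]) auto
  moreover have "covers ?S F"
  proof -
    have "u \<in> ?S \<or> v \<in> ?S" if F_uv: "(u, v) \<in> F" for u v
    proof -
      have uv: "u \<in> Field F" "v \<in> Field F" "(u, v) \<in> parcs G"
        using F F_uv unfolding Field_def by auto
      \<comment> \<open>The quotient has no arc from a class to itself, so the two ends of an arc of
        \<open>F\<close> must lie in different classes.\<close>
      then have "u \<noteq> v" using pair_no_loops by fastforce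
      then have "?c u \<noteq> ?c v" using uv inj' unfolding inj_on_def by blast
      then have "(?c u, ?c v) \<in> quotient_arcs G g"
      proof -
        have "u \<in> pverts G" "v \<in> pverts G" using uv FV by auto
        moreover from this have "bis G (?c u) (?c v)"
          using uv(3) unfolding bis_def colour_class_def by blast
        ultimately show ?thesis
          using \<open>?c u \<noteq> ?c v\<close> unfolding quotient_arcs_def class_pairs_def by simp
      qed
      then have "?c u \<in> C \<or> ?c v \<in> C" using C(3) unfolding covers_def by blast
      then show ?thesis using uv by simp
    qed
    then show ?thesis unfolding covers_def by blast
  qed
  ultimately show ?thesis using C(2) finS unfolding coverable_def by (meson le_trans)
qed

section \<open>Random colourings\<close>

definition random_colouring :: "'a set \<Rightarrow> nat \<Rightarrow> ('a \<Rightarrow> nat) pmf" where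
  "random_colouring V m = Pi_pmf V 0 (\<lambda>_. pmf_of_set {..<m})"

lemma prob_pmf_of_set_singleton_le: "m > 0 \<Longrightarrow> measure_pmf.prob (pmf_of_set {..<m :: nat}) {c} \<le> 1 / m"
  by (simp add: measure_pmf_single pmf_of_set indicator_def lessThan_empty_iff)

text \<open>Fix all colours but that of \<open>u\<close>; by independence, \<open>u\<close> then
  hits the single bad colour with probability at most \<open>1 / m\<close>.\<close>

lemma prob_collision_le:
  assumes "finite V" "u \<in> V" "u \<noteq> v" "m > 0"
  shows "measure_pmf.prob (random_colouring V m) {g. g u = g v} \<le> 1 / m"
proof -
  let ?U = "pmf_of_set {..<m}"
  have V: "V = insert u (V - {u})" using assms(2) by blast
  have "random_colouring V m =
      Pi_pmf (V - {u}) 0 (\<lambda>_. ?U) \<bind> (\<lambda>f. map_pmf (\<lambda>c. f(u := c)) ?U)"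
    unfolding random_colouring_def
    by (subst V, subst Pi_pmf_insert')
      (use assms in \<open>simp_all add: map_pmf_def bind_commute_pmf[of ?U]\<close>)
  then have "emeasure (random_colouring V m) {g. g u = g v} =
      (\<integral>\<^sup>+f. emeasure (map_pmf (\<lambda>c. f(u := c)) ?U) {g. g u = g v}
        \<partial>Pi_pmf (V - {u}) 0 (\<lambda>_. ?U))"
    by (simp only: emeasure_bind_pmf)
  also have "\<dots> \<le> (\<integral>\<^sup>+f. ennreal (1 / real m) \<partial>Pi_pmf (V - {u}) 0 (\<lambda>_. ?U))"
  proof (rule nn_integral_mono)
    fix f :: "'a \<Rightarrow> nat"
    \<comment> \<open>As \<open>u\<close> and \<open>v\<close> differ, recolouring \<open>u\<close>
      leaves the colour of \<open>v\<close> at \<open>f v\<close>.\<close>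
    have "(\<lambda>c. f(u := c)) -` {g. g u = g v} = {f v}" using assms(3) by auto
    then have "emeasure (map_pmf (\<lambda>c. f(u := c)) ?U) {g. g u = g v} = emeasure ?U {f v}"
      by (simp only: emeasure_map_pmf)
    also have "\<dots> \<le> ennreal (1 / real m)"
      using prob_pmf_of_set_singleton_le[OF assms(4), of "f v"]
      by (simp only: measure_pmf.emeasure_eq_measure ennreal_leI)
    finally show "emeasure (map_pmf (\<lambda>c. f(u := c)) ?U) {g. g u = g v} \<le> ennreal (1 / real m)" .
  qed
  also have "\<dots> = ennreal (1 / real m)" by simp
  finally show ?thesis by (simp add: measure_pmf.emeasure_eq_measure)
qed

lemma prob_not_inj_on_le:
  assumes "finite V" "W \<subseteq> V" "m > 0"
  shows "measure_pmf.prob (random_colouring V m) {g. \<not> inj_on g W} \<le> real (card W ^ 2) / m"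
proof -
  let ?D = "random_colouring V m"
  \<comment> \<open>The union bound runs over ordered pairs, so each possible collision is counted
    twice; the bound remains below \<open>card W ^ 2 / m\<close>.\<close>
  let ?Q = "{p \<in> W \<times> W. fst p \<noteq> snd p}"
  have finW: "finite W" using assms finite_subset by blast
  then have finQ: "finite ?Q" by (intro finite_subset[of ?Q "W \<times> W"]) auto
  have "{g :: 'a \<Rightarrow> nat. \<not> inj_on g W} = (\<Union>p \<in> ?Q. {g. g (fst p) = g (snd p)})"
    unfolding inj_on_def by fastforce
  then have "measure_pmf.prob ?D {g. \<not> inj_on g W} =
      measure_pmf.prob ?D (\<Union>p \<in> ?Q. {g. g (fst p) = g (snd p)})"
    by (simp only:)
  also have "\<dots> \<le> (\<Sum>p \<in> ?Q. measure_pmf.prob ?D {g. g (fst p) = g (snd p)})"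
    by (rule measure_pmf.finite_measure_subadditive_finite[OF finQ]) simp
  also have "\<dots> \<le> (\<Sum>p \<in> ?Q. 1 / m)"
    using assms by (intro sum_mono prob_collision_le) auto
  also have "\<dots> = real (card ?Q) / m" by simp
  also have "\<dots> \<le> real (card (W \<times> W)) / m"
    using finW by (intro divide_right_mono of_nat_mono card_mono) auto
  finally show ?thesis by (simp add: card_cartesian_product power2_eq_square)
qed

section \<open>The algorithm\<close>

text \<open>Fair coins yield uniform numbers below a power of two, one toss per binary digit; the
  first toss decides the top digit.\<close>

fun choose_colour :: "nat \<Rightarrow> (nat \<Rightarrow> 'a query_alg) \<Rightarrow> 'a query_alg" where
  "choose_colour 0 f = f 0"
| "choose_colour (Suc r) f =
    Coin (choose_colour r (\<lambda>c. f (c + 2 ^ r))) (choose_colour r f)"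

text \<open>The two halves of the range are equally likely. For \<open>m = 2 ^ r\<close> this is the
  induction step of \<open>run_choose_colour\<close>.\<close>

lemma pmf_of_set_lessThan_double:
  assumes "m > 0"
  shows "pmf_of_set {..<2 * m :: nat} = bernoulli_pmf (1 / 2) \<bind>
    (\<lambda>h. if h then map_pmf (\<lambda>c. c + m) (pmf_of_set {..<m}) else pmf_of_set {..<m})"
    (is "_ = ?p")
proof (rule pmf_eqI)
  fix i
  have "map_pmf (\<lambda>c. c + m) (pmf_of_set {..<m}) = pmf_of_set ((\<lambda>c. c + m) ` {..<m})"
    using assms by (intro map_pmf_of_set_inj) (auto simp: inj_on_def lessThan_empty_iff)
  also have "(\<lambda>c. c + m) ` {..<m} = {m..<2 * m}"
    using image_add_atLeastLessThan'[of m 0 m] by (simp add: lessThan_atLeast0 mult_2)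
  finally show "pmf (pmf_of_set {..<2 * m}) i = pmf ?p i"
    using assms by (auto simp: pmf_bind pmf_of_set lessThan_empty_iff indicator_def)
qed

lemma run_choose_colour:
  "run orc (choose_colour r f) = pmf_of_set {..<2 ^ r} \<bind> (\<lambda>c. run orc (f c))"
proof (induction r arbitrary: f)
  case 0
  have "{..<1 :: nat} = {0}" by auto
  then show ?case by (simp add: pmf_of_set_singleton bind_return_pmf)
next
  case (Suc r)
  then show ?case
    by (simp add: pmf_of_set_lessThan_double bind_assoc_pmf bind_map_pmf if_distrib
        if_distribR cong: if_cong)
qed

text \<open>In continuation style, since the queries that follow depend on the colouring. The
  initial function \<open>\<lambda>_. 0\<close> matches the default value in
  \<open>random_colouring\<close>.\<close>

fun choose_colouring ::
    "nat \<Rightarrow> 'b list \<Rightarrow> (('b \<Rightarrow> nat) \<Rightarrow> 'a query_alg) \<Rightarrow> 'a query_alg" where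
  "choose_colouring r [] f = f (\<lambda>_. 0)"
| "choose_colouring r (x # xs) f =
    choose_colour r (\<lambda>c. choose_colouring r xs (\<lambda>g. f (g(x := c))))"

lemma run_choose_colouring:
  assumes "distinct xs"
  shows "run orc (choose_colouring r xs f) =
    random_colouring (set xs) (2 ^ r) \<bind> (\<lambda>g. run orc (f g))"
  using assms
proof (induction xs arbitrary: f)
  case Nil
  then show ?case by (simp add: random_colouring_def bind_return_pmf)
next
  case (Cons x xs)
  then show ?case
    by (simp add: random_colouring_def run_choose_colour Pi_pmf_insert' bind_assoc_pmf
        bind_return_pmf)
qed

lemma legal_choose_colour:
  "(\<And>c. legal_bis_queries V (f c)) \<Longrightarrow> legal_bis_queries V (choose_colour r f)"
  by (induction r arbitrary: f) auto

lemma legal_choose_colouring: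
  "(\<And>g. legal_bis_queries V (f g)) \<Longrightarrow> legal_bis_queries V (choose_colouring r xs f)"
  by (induction xs arbitrary: f) (auto intro: legal_choose_colour)

section \<open>Asking a fixed list of pairs\<close>

text \<open>Non-adaptive: both branches continue with the same pairs, while \<open>Y\<close>
  accumulates those answered yes.\<close>

fun query_all ::
    "('a set \<times> 'a set) list \<Rightarrow> 'a set rel \<Rightarrow> ('a set rel \<Rightarrow> bool) \<Rightarrow> 'a query_alg" where
  "query_all [] Y F = Answer (F Y)"
| "query_all ((A, B) # ps) Y F =
    Query A B (query_all ps (insert (A, B) Y) F) (query_all ps Y F)"

lemma run_query_all:
  "run orc (query_all ps Y F) =
    return_pmf (F (Y \<union> {(A, B) \<in> set ps. orc A B}), length ps)"
proof (induction ps arbitrary: Y)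
  case (Cons p ps)
  obtain A B where p: "p = (A, B)" by fastforce
  have "{(A', B'). (A' = A \<and> B' = B \<or> (A', B') \<in> set ps) \<and> orc A' B'} =
      (if orc A B then insert (A, B) else id) {(A, B) \<in> set ps. orc A B}"
    by auto
  then show ?case using Cons by (auto simp: p)
qed simp

lemma legal_query_all:
  "\<forall>(A, B) \<in> set ps. A \<subseteq> V \<and> B \<subseteq> V \<and> A \<noteq> {} \<and> B \<noteq> {} \<and> A \<inter> B = {} \<Longrightarrow>
    legal_bis_queries V (query_all ps Y F)"
  by (induction ps arbitrary: Y) auto

definition list_of_set :: "'a set \<Rightarrow> 'a list" where
  "list_of_set A = (SOME xs. set xs = A \<and> distinct xs)"

lemma list_of_set:
  assumes "finite A"
  shows "set (list_of_set A) = A" "distinct (list_of_set A)" "length (list_of_set A) = card A"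
proof -
  have "set (list_of_set A) = A \<and> distinct (list_of_set A)"
    unfolding list_of_set_def by (rule someI_ex) (use finite_distinct_list[OF assms] in blast)
  then show "set (list_of_set A) = A" "distinct (list_of_set A)" "length (list_of_set A) = card A"
    using distinct_card by fastforce+
qed

section \<open>The algorithm, its query count and its error\<close>

text \<open>The parameter \<open>r\<close> is the number of tosses per vertex, giving
  \<open>2 ^ r\<close> colours. Evaluating \<open>coverable k\<close> on the collected answers costs
  no queries.\<close>

definition vc_alg :: "nat \<Rightarrow> 'a set \<Rightarrow> nat \<Rightarrow> 'a query_alg" where
  "vc_alg r V k = choose_colouring r (list_of_set V)
    (\<lambda>g. query_all (list_of_set (class_pairs V g)) {} (coverable k))"

lemma legal_vc_alg:
  assumes "finite V"
  shows "legal_bis_queries V (vc_alg r V k)"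
  unfolding vc_alg_def
  by (intro legal_choose_colouring legal_query_all)
    (use class_pairs_legal in \<open>fastforce simp: list_of_set finite_class_pairs assms\<close>)

text \<open>The pairs answered yes are exactly the arcs of the quotient, so all randomness lies in
  the colouring.\<close>

lemma run_vc_alg:
  assumes "finite (pverts G)"
  shows "run (bis G) (vc_alg r (pverts G) k) =
    map_pmf (\<lambda>g. (coverable k (quotient_arcs G g), card (class_pairs (pverts G) g)))
      (random_colouring (pverts G) (2 ^ r))"
  by (simp add: vc_alg_def run_choose_colouring run_query_all list_of_set finite_class_pairs
      assms quotient_arcs_def map_pmf_def)

lemma vc_alg_queries:
  assumes "finite (pverts G)" "(b, n) \<in> set_pmf (run (bis G) (vc_alg r (pverts G) k))"
  shows "n \<le> (2 ^ r) ^ 2"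
proof -
  obtain g where g: "g \<in> set_pmf (random_colouring (pverts G) (2 ^ r))"
    and n: "n = card (class_pairs (pverts G) g)"
    using assms by (auto simp: run_vc_alg)
  have "g ` pverts G \<subseteq> {..<2 ^ r}"
    using g set_Pi_pmf_subset'[OF assms(1)] assms(1)
    by (auto simp: random_colouring_def set_Pi_pmf PiE_dflt_def lessThan_empty_iff)
  then show ?thesis unfolding n by (rule card_class_pairs_le[OF assms(1)])
qed

lemma vc_alg_correct:
  assumes G: "pair_graph G"
  shows "measure_pmf.prob (run (bis G) (vc_alg r (pverts G) k))
      {(b, n). b \<longleftrightarrow> has_vertex_cover_of_size_at_most G k} \<ge> 1 - real ((2 * (k + 1)) ^ 2) / 2 ^ r"
proof -
  interpret pair_graph G by fact
  let ?V = "pverts G" and ?D = "random_colouring (pverts G) (2 ^ r)"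
  let ?ok = "{g :: 'a \<Rightarrow> nat. coverable k (quotient_arcs G g) \<longleftrightarrow> coverable k (parcs G)}"
  have eq: "measure_pmf.prob (run (bis G) (vc_alg r ?V k))
      {(b, n). b \<longleftrightarrow> has_vertex_cover_of_size_at_most G k} = measure_pmf.prob ?D ?ok"
    by (simp add: run_vc_alg vimage_def has_vertex_cover_iff_coverable[OF G])
  show ?thesis
  proof (cases "coverable k (parcs G)")
    case True
    then have "?ok = UNIV" by (simp add: coverable_quotient_arcs)
    then have "measure_pmf.prob ?D ?ok = 1" using measure_pmf.prob_space[of ?D] by simp
    then show ?thesis unfolding eq by simp
  next
    case False
    then obtain F where F: "F \<subseteq> parcs G" "\<not> coverable k F" "card (Field F) \<le> 2 * (k + 1)"
      using small_not_coverable_subset pair_finite_arcs by blast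
    have FV: "Field F \<subseteq> ?V"
      using F(1) in_arcsD1 in_arcsD2 unfolding Field_def by blast
    have "1 - measure_pmf.prob ?D ?ok = measure_pmf.prob ?D (- ?ok)"
      using measure_pmf.prob_compl[of ?ok ?D] by (simp add: Compl_eq_Diff_UNIV)
    \<comment> \<open>An error here means that the quotient is coverable; were \<open>g\<close>
      injective on \<open>Field F\<close>, then \<open>F\<close> would be coverable too.\<close>
    also have "\<dots> \<le> measure_pmf.prob ?D {g. \<not> inj_on g (Field F)}"
      using coverable_if_coverable_quotient_arcs[OF G F(1)] F(2) False
      by (intro measure_pmf.finite_measure_mono) auto
    also have "\<dots> \<le> real (card (Field F) ^ 2) / real (2 ^ r)"
      by (rule prob_not_inj_on_le) (use FV in auto)
    also have "\<dots> \<le> real ((2 * (k + 1)) ^ 2) / real (2 ^ r)"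
      using F(3) by (intro divide_right_mono of_nat_mono power_mono) simp_all
    also have "\<dots> = real ((2 * (k + 1)) ^ 2) / 2 ^ r" by simp
    finally show ?thesis unfolding eq by linarith
  qed
qed

section \<open>Choice of the number of colours\<close>

lemma ex_power_two_between:
  assumes "n \<ge> (1 :: nat)"
  shows "\<exists>r. n \<le> 2 ^ r \<and> 2 ^ r \<le> 2 * n"
proof -
  obtain r where r: "2 ^ r \<le> n" "n < 2 ^ (r + 1)"
    using ex_power_ivl1[of 2 n] assms by auto
  then show ?thesis by (intro exI[of _ "r + 1"]) auto
qed

theorem theorem3:
  shows "\<exists>(alg :: 'a set \<Rightarrow> nat \<Rightarrow> 'a query_alg) (q :: nat \<Rightarrow> nat) (c :: real).
    c > 0 \<and>
    (\<lambda>k. real (q k)) \<in> O(\<lambda>k. real k ^ 8 * ln (real k)) \<and>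
    (\<forall>V k. finite V \<and> k \<ge> 1 \<longrightarrow> legal_bis_queries V (alg V k)) \<and>
    (\<forall>G k. pair_graph G \<and> k \<ge> 1 \<longrightarrow>
      (\<forall>(b, m) \<in> set_pmf (run (bis G) (alg (pverts G) k)). m \<le> q k) \<and>
      measure_pmf.prob (run (bis G) (alg (pverts G) k))
        {(b, m). b \<longleftrightarrow> has_vertex_cover_of_size_at_most G k} \<ge> 1 - 1 / real k powr c)"
proof -
  \<comment> \<open>At most \<open>2 * (k + 1) \<le> 4 * k\<close> vertices must get distinct
    colours, which fails with probability at most \<open>16 * k ^ 2 / 2 ^ r\<close>. With at least
    \<open>16 * k ^ 3\<close> colours this is at most \<open>1 / k\<close>; rounding up to a power
    of two costs a factor of 2.\<close>
  have "\<exists>r. 16 * k ^ 3 \<le> 2 ^ r \<and> 2 ^ r \<le> 2 * (16 * k ^ 3)" if "k \<ge> 1" for k :: nat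
    using that by (intro ex_power_two_between) simp
  then obtain r :: "nat \<Rightarrow> nat" where
    r: "\<And>k. k \<ge> 1 \<Longrightarrow> 16 * k ^ 3 \<le> 2 ^ r k" "\<And>k. k \<ge> 1 \<Longrightarrow> 2 ^ r k \<le> 32 * k ^ 3"
    by simp metis
  \<comment> \<open>The bound \<open>1024 * k ^ 6\<close> is the square of the maximal number
    \<open>32 * k ^ 3\<close> of colours.\<close>
  let ?alg = "\<lambda>V k. vc_alg (r k) V k" and ?q = "\<lambda>k. 1024 * k ^ 6 :: nat"
  have "(\<lambda>k. real (?q k)) \<in> O(\<lambda>k. real k ^ 8 * ln (real k))"
    by simp real_asymp
  moreover have "m \<le> ?q k"
    if "pair_graph G" "k \<ge> 1" "(b, m) \<in> set_pmf (run (bis G) (?alg (pverts G) k))"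
    for G :: "'a pair_pre_digraph" and k b m
  proof -
    interpret pair_graph G by fact
    have "m \<le> (2 ^ r k) ^ 2" using vc_alg_queries[OF pair_finite_verts that(3)] .
    also have "\<dots> \<le> (32 * k ^ 3) ^ 2" using r(2)[OF that(2)] by (rule power_mono) simp
    also have "\<dots> = ?q k" by (simp add: power_mult_distrib flip: power_mult)
    finally show ?thesis .
  qed
  moreover have "1 - 1 / real k powr 1 \<le> measure_pmf.prob (run (bis G) (?alg (pverts G) k))
        {(b, m). b \<longleftrightarrow> has_vertex_cover_of_size_at_most G k}"
    if "pair_graph G" "k \<ge> 1" for G :: "'a pair_pre_digraph" and k
  proof -
    \<comment> \<open>Here \<open>k \<ge> 1\<close> gives \<open>k + 1 \<le> 2 * k\<close>.\<close>
    have "(2 * (k + 1)) ^ 2 * k \<le> (4 * k) ^ 2 * k"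
      using that(2) by (intro mult_right_mono power_mono) auto
    also have "\<dots> = 16 * k ^ 3" by (simp add: power2_eq_square power3_eq_cube)
    also have "\<dots> \<le> 2 ^ r k" using r(1)[OF that(2)] .
    finally have "real ((2 * (k + 1)) ^ 2 * k) \<le> real (2 ^ r k)" by (rule of_nat_mono)
    then have "real ((2 * (k + 1)) ^ 2) / 2 ^ r k \<le> 1 / real k powr 1"
      using that(2) by (simp add: field_simps)
    then show ?thesis using vc_alg_correct[OF that(1), of k "r k"] by linarith
  qed
  ultimately show ?thesis
    by (intro exI[of _ ?alg] exI[of _ ?q] exI[of _ "1 :: real"]) (auto simp: legal_vc_alg)
qed

end
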